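(* Let $A$ be a polarized complex Abelian variety of dimension $2$. For an integer $t\ge 1$ let $N_A(t)$ be the number of elliptic curves in $A$ of degree $\le t$ with respect to the polarization. Then $N_A(t)$ has an upper bound which is asymptotically of order $O(t^3)$; that is, $N_A(t)=O(t^3)$ as $t\to\infty$ (with implied constant depending on $A$ and its polarization).
   Context: "Elliptic curve in" a complex torus $A$ means a one-dimensional complex subtorus of $A$ (so it passes through the origin). The degree of an elliptic curve $F\subset A$ with respect to a polarization with associated divisor $\Theta$ is the intersection number $F\cdot\Theta$. *)

theory Defs
  imports "HOL-Complex_Analysis.Complex_Analysis" "HOL-Library.Landau_Symbols"
begin

section \<open>Complex tori of dimension two\<close>

definition lattice_in :: "'v::euclidean_space set \<Rightarrow> 'v set \<Rightarrow> bool" where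
  "lattice_in W \<Lambda> \<longleftrightarrow>
     0 \<in> \<Lambda> \<and> (\<forall>x\<in>\<Lambda>. \<forall>y\<in>\<Lambda>. x - y \<in> \<Lambda>) \<and> discrete \<Lambda> \<and> span \<Lambda> = W"

text \<open>Here \<open>span\<close> is the real span, so that \<open>lattice_in W \<Lambda>\<close> makes \<open>\<Lambda>\<close> a lattice of
  full real rank in the subspace \<open>W\<close>.  Points of the torus are the cosets of \<open>\<Lambda>\<close>.\<close>

definition torus_proj :: "(complex ^ 2) set \<Rightarrow> complex ^ 2 \<Rightarrow> (complex ^ 2) set" where
  "torus_proj \<Lambda> z = (\<lambda>x. z + x) ` \<Lambda>"

definition elliptic_curves :: "(complex ^ 2) set \<Rightarrow> (complex ^ 2) set set set" where
  "elliptic_curves \<Lambda> =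
     {torus_proj \<Lambda> ` W | W. vec.subspace W \<and> vec.dim W = 1 \<and> lattice_in W (W \<inter> \<Lambda>)}"

section \<open>Polarizations and their divisors\<close>

definition hermitian_form :: "(complex ^ 2 \<Rightarrow> complex ^ 2 \<Rightarrow> complex) \<Rightarrow> bool" where
  "hermitian_form H \<longleftrightarrow>
     (\<forall>x y z. H (x + y) z = H x z + H y z) \<and>
     (\<forall>c x y. H (c *s x) y = c * H x y) \<and>
     (\<forall>x y. H y x = cnj (H x y))"

definition polarization ::
    "(complex ^ 2) set \<Rightarrow> (complex ^ 2 \<Rightarrow> complex ^ 2 \<Rightarrow> complex) \<Rightarrow> bool" where
  "polarization \<Lambda> H \<longleftrightarrow>
     hermitian_form H \<and>
     (\<forall>x. x \<noteq> 0 \<longrightarrow> Re (H x x) > 0) \<and>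
     (\<forall>x\<in>\<Lambda>. \<forall>y\<in>\<Lambda>. Im (H x y) \<in> \<int>)"

definition holomorphic_C2 :: "(complex ^ 2 \<Rightarrow> complex) \<Rightarrow> bool" where
  "holomorphic_C2 f \<longleftrightarrow>
     (\<forall>z. \<exists>D. (f has_derivative D) (at z) \<and> (\<forall>c v. D (c *s v) = c * D v))"

definition semicharacter ::
    "(complex ^ 2) set \<Rightarrow> (complex ^ 2 \<Rightarrow> complex ^ 2 \<Rightarrow> complex) \<Rightarrow>
     (complex ^ 2 \<Rightarrow> complex) \<Rightarrow> bool" where
  "semicharacter \<Lambda> H \<alpha> \<longleftrightarrow>
     (\<forall>x\<in>\<Lambda>. norm (\<alpha> x) = 1) \<and>
     (\<forall>x\<in>\<Lambda>. \<forall>y\<in>\<Lambda>. \<alpha> (x + y) = \<alpha> x * \<alpha> y * exp (\<i> * of_real (pi * Im (H x y))))"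

text \<open>By the Appell--Humbert theorem the line bundles with first Chern class \<open>H\<close> are those
  given by the factors of automorphy below, one for each semicharacter \<open>\<alpha>\<close>, and their sections
  are the holomorphic functions with this functional equation.  Hence the effective divisors
  \<open>\<Theta>\<close> on the torus whose line bundle has first Chern class \<open>H\<close> are exactly the zero divisors of
  the functions \<open>\<theta>\<close> below; a divisor \<open>\<Theta>\<close> is represented by such a \<open>\<theta>\<close>.\<close>

definition theta_function ::
    "(complex ^ 2) set \<Rightarrow> (complex ^ 2 \<Rightarrow> complex ^ 2 \<Rightarrow> complex) \<Rightarrow>
     (complex ^ 2 \<Rightarrow> complex) \<Rightarrow> bool" where
  "theta_function \<Lambda> H \<theta> \<longleftrightarrow>
     holomorphic_C2 \<theta> \<and> (\<exists>z. \<theta> z \<noteq> 0) \<and>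
     (\<exists>\<alpha>. semicharacter \<Lambda> H \<alpha> \<and>
       (\<forall>x\<in>\<Lambda>. \<forall>z. \<theta> (z + x) =
          \<alpha> x * exp (of_real pi * H z x + of_real (pi / 2) * H x x) * \<theta> z))"

section \<open>Intersection numbers\<close>

text \<open>The vectors whose complex one-parameter group stays in \<open>F\<close>: for \<open>F = torus_proj \<Lambda> ` W\<close>
  as above this is the tangent line \<open>W\<close>.\<close>

definition tangent_line :: "(complex ^ 2) set \<Rightarrow> (complex ^ 2) set set \<Rightarrow> (complex ^ 2) set" where
  "tangent_line \<Lambda> F = {w. \<forall>c. torus_proj \<Lambda> (c *s w) \<in> F}"

definition tangent_vector :: "(complex ^ 2) set \<Rightarrow> (complex ^ 2) set set \<Rightarrow> complex ^ 2" where
  "tangent_vector \<Lambda> F = (SOME w. w \<in> tangent_line \<Lambda> F \<and> w \<noteq> 0)"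

text \<open>Let \<open>\<Theta>\<close> be the divisor of \<open>\<theta>\<close> and \<open>\<Theta> - x\<close> its translate, the divisor of
  \<open>\<lambda>z. \<theta> (x + z)\<close>.  Since \<open>F\<close> is smooth, the local intersection multiplicity of \<open>F\<close> and
  \<open>\<Theta> - x\<close> at a point \<open>p\<close> of \<open>F\<close> is the vanishing order at \<open>p\<close> of the local equation restricted
  to \<open>F\<close>.  By quasi-periodicity of \<open>\<theta>\<close> it depends neither on the representative of the coset
  \<open>p\<close> nor on the tangent vector.\<close>

definition local_mult ::
    "(complex ^ 2) set \<Rightarrow> (complex ^ 2 \<Rightarrow> complex) \<Rightarrow> complex ^ 2 \<Rightarrow>
     (complex ^ 2) set set \<Rightarrow> (complex ^ 2) set \<Rightarrow> int" where
  "local_mult \<Lambda> \<theta> x F p =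
     zorder (\<lambda>s. \<theta> (x + (SOME z. z \<in> p) + s *s tangent_vector \<Lambda> F)) 0"

definition proper_translate ::
    "(complex ^ 2 \<Rightarrow> complex) \<Rightarrow> complex ^ 2 \<Rightarrow> (complex ^ 2) set set \<Rightarrow> bool" where
  "proper_translate \<theta> x F \<longleftrightarrow> (\<exists>p\<in>F. \<exists>z\<in>p. \<theta> (x + z) \<noteq> 0)"

definition proper_intersection ::
    "(complex ^ 2) set \<Rightarrow> (complex ^ 2 \<Rightarrow> complex) \<Rightarrow> complex ^ 2 \<Rightarrow>
     (complex ^ 2) set set \<Rightarrow> int" where
  "proper_intersection \<Lambda> \<theta> x F =
     (\<Sum>p \<in> {p \<in> F. \<forall>z\<in>p. \<theta> (x + z) = 0}. local_mult \<Lambda> \<theta> x F p)"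

text \<open>The intersection number of \<open>F\<close> and \<open>\<Theta>\<close>.  Intersection numbers are invariant under
  translation, so if \<open>F\<close> is contained in \<open>\<Theta>\<close> one moves \<open>\<Theta>\<close> to a translate that does not contain
  \<open>F\<close>; the value does not depend on the choice of the translate.\<close>

definition curve_degree ::
    "(complex ^ 2) set \<Rightarrow> (complex ^ 2 \<Rightarrow> complex) \<Rightarrow> (complex ^ 2) set set \<Rightarrow> int" where
  "curve_degree \<Lambda> \<theta> F = proper_intersection \<Lambda> \<theta> (SOME x. proper_translate \<theta> x F) F"

definition curves_upto ::
    "(complex ^ 2) set \<Rightarrow> (complex ^ 2 \<Rightarrow> complex) \<Rightarrow> nat \<Rightarrow> (complex ^ 2) set set set" where
  "curves_upto \<Lambda> \<theta> t = {F \<in> elliptic_curves \<Lambda>. curve_degree \<Lambda> \<theta> F \<le> int t}"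

end

(* An elliptic curve F with tangent line W corresponds to the plane lattice of periods lying in W.
   Restricted to (a translate of) W, theta is an entire function that is quasi-periodic under this
   lattice, so the argument principle on a period parallelogram shows that the degree of F is the
   H-area of that parallelogram.  For a reduced basis of periods the area is at least half the
   squared H-length of the shortest period, so W contains a nonzero lattice vector v with
   H(v,v) <= 2 deg F, and v determines F since W is the complex line through v.  Hence the curves of
   degree <= t inject into the lattice points in a ball of radius O(sqrt t), of which there are
   O(t^2) because the lattice has rank 4. *)

theory Submission
  imports Defs
begin

section \<open>Zeros of quasi-periodic entire functions\<close>

text \<open>The degree is a sum of local multiplicities over points of the curve, so it has to be
  bounded by actually counting zeros. Only one inequality is established: the degree is at least the
  H-area of the parallelogram. The zeros in a translated open parallelogram give distinct points of
  the curve, and further points could only add nonnegative orders. So in place of a proof that the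
  two short periods generate the lattice, it is enough that no two points of the parallelogram are
  congruent. The finiteness of the set of zeros on the curve must still be shown, because a sum over
  an infinite set is 0 and would make the degree meaningless. The factor 2 is generous: Gauss
  reduction gives 2 / sqrt 3. The resulting bound of order t^2 implies the stated one because t
  \<ge> 1.\<close>

lemma zeros_finite_entire:
  fixes f :: "complex \<Rightarrow> complex"
  assumes "f holomorphic_on UNIV" "f z0 \<noteq> 0" "compact K"
  shows "finite {z\<in>K. f z = 0}"
proof (cases "f constant_on UNIV")
  case True
  then have "{z\<in>K. f z = 0} = {}"
    using assms(2) by (auto simp: constant_on_def)
  then show ?thesis by (simp only: finite.emptyI)
next
  case False
  then show ?thesis
    using holomorphic_compact_finite_zeros[OF assms(1) open_UNIV connected_UNIV assms(3) _ False] by simp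
qed

lemma zeros_countable_entire:
  fixes f :: "complex \<Rightarrow> complex"
  assumes "f holomorphic_on UNIV" "f z0 \<noteq> 0"
  shows "countable {z. f z = 0}"
proof -
  have "{z. f z = 0} = (\<Union>n. {z \<in> cball 0 (real n). f z = 0})"
    by (auto intro: real_arch_simple)
  then show ?thesis
    using zeros_finite_entire[OF assms compact_cball] by (simp only: countable_UN countableI_type countable_finite)
qed

text \<open>Argument principle on a triangle. Its frontier is the boundary path itself, and the
  winding number about an interior point is 1 or -1 according to the sign of a determinant, which
  \<open>orient\<close> makes positive.\<close>

lemma triangle_zero_count:
  fixes f :: "complex \<Rightarrow> complex"
  assumes hol: "f holomorphic_on UNIV" and nz: "f z0 \<noteq> 0"
    and orient: "Im (cnj (b - a) * (c - a)) > 0"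
    and seg: "\<And>z. z \<in> closed_segment a b \<union> closed_segment b c \<union> closed_segment c a \<Longrightarrow> f z \<noteq> 0"
  defines "g \<equiv> \<lambda>z. deriv f z / f z"
  defines "T \<equiv> {z \<in> interior (convex hull {a, b, c}). f z = 0}"
  shows "contour_integral (linepath a b) g + contour_integral (linepath b c) g
           + contour_integral (linepath c a) g = 2 * pi * \<i> * (\<Sum>p\<in>T. of_int (zorder f p))"
proof -
  let ?\<gamma> = "linepath a b +++ linepath b c +++ linepath c a"
  let ?hull = "convex hull {a, b, c}"
  obtain R where R: "?hull \<subseteq> ball 0 R"
    using bounded_subset_ballD[OF bounded_convex_hull[of "{a,b,c}"]] by (meson finite_imp_bounded finite.intros)
  have img: "path_image ?\<gamma> = closed_segment a b \<union> closed_segment b c \<union> closed_segment c a"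
    by (auto simp: path_image_join)
  have fr: "frontier ?hull = path_image ?\<gamma>"
    unfolding img by (rule frontier_of_triangle) simp
  have "closed ?hull" by (simp add: compact_imp_closed finite_imp_compact_convex_hull)
  then have img_hull: "path_image ?\<gamma> \<subseteq> ?hull"
    unfolding fr[symmetric] by (rule frontier_subset_closed)
  have inside: "p \<in> interior ?hull" if "p \<in> ?hull" "f p = 0" for p
    using that fr img seg \<open>closed ?hull\<close> by (auto simp: frontier_def)
  have wn1: "winding_number ?\<gamma> p = 1" if p: "p \<in> T" for p
  proof -
    have "p \<in> ?hull" using p interior_subset by (auto simp: T_def)
    then obtain u v w where uvw: "u \<ge> 0" "v \<ge> 0" "w \<ge> 0" "u + v + w = 1"
      "p = u *\<^sub>R a + v *\<^sub>R b + w *\<^sub>R c"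
      unfolding convex_hull_3 by auto
    have "w \<noteq> 0"
    proof
      assume "w = 0"
      then have "p \<in> closed_segment a b"
        using uvw by (auto simp: in_segment intro!: exI[of _ v])
      then show False using seg p by (auto simp: T_def)
    qed
    have u: "u = 1 - v - w" using uvw by simp
    \<comment> \<open>The sign of the left side decides between winding number 1 and -1. It is the
      determinant of the triangle scaled by the barycentric coordinate \<open>w\<close> of
      \<open>p\<close> at \<open>c\<close>.\<close>
    have "Im ((b - a) * cnj (b - p)) = w * Im (cnj (b - a) * (c - a))"
      unfolding uvw(5) u by (simp add: algebra_simps)
    then have "Im ((b - a) * cnj (b - p)) > 0"
      using orient \<open>w \<noteq> 0\<close> uvw by simp
    then show ?thesis
      using p winding_number_triangle by (auto simp: T_def)
  qed
  have wn0: "winding_number ?\<gamma> z = 0" if "z \<notin> ?hull" for z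
    by (rule winding_number_zero_outside[OF _ _ _ that img_hull]) auto
  \<comment> \<open>Zeros and poles in the shape that \<open>argument_principle\<close> expects,
    with an empty set of poles. Working in a ball around the triangle keeps the set finite, which
    can fail in the whole plane.\<close>
  define pz where "pz = {w \<in> ball 0 R. f w = 0 \<or> w \<in> {}}"
  have fin: "finite pz"
    unfolding pz_def
    by (rule finite_subset[OF _ zeros_finite_entire[OF hol nz compact_cball[of 0 R]]]) auto
  have "contour_integral ?\<gamma> (\<lambda>x. deriv f x * 1 / f x)
          = 2 * pi * \<i> * (\<Sum>p\<in>pz. winding_number ?\<gamma> p * 1 * zorder f p)"
    unfolding pz_def
  proof (rule argument_principle[where h = "\<lambda>_. 1"])
    show "f holomorphic_on ball 0 R - {}"
      using hol holomorphic_on_subset by blast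
    show "path_image ?\<gamma> \<subseteq> ball 0 R - {w \<in> ball 0 R. f w = 0 \<or> w \<in> {}}"
      using img_hull R img seg by auto
    show "\<forall>z. z \<notin> ball 0 R \<longrightarrow> winding_number ?\<gamma> z = 0"
      using R wn0 by blast
    show "finite {w \<in> ball 0 R. f w = 0 \<or> w \<in> {}}"
      using fin by (simp add: pz_def)
  qed (auto intro!: valid_path_join)
  also have "(\<Sum>p\<in>pz. winding_number ?\<gamma> p * 1 * zorder f p) = (\<Sum>p\<in>T. of_int (zorder f p))"
  proof (rule sum.mono_neutral_cong_right[OF fin])
    show "T \<subseteq> pz" using R by (auto simp: pz_def T_def dest: interior_subset[THEN subsetD])
    show "\<forall>i\<in>pz - T. winding_number ?\<gamma> i * 1 * zorder f i = 0"
      using inside wn0 by (auto simp: pz_def T_def)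
  qed (simp add: wn1)
  finally have eq: "contour_integral ?\<gamma> g = 2 * pi * \<i> * (\<Sum>p\<in>T. of_int (zorder f p))"
    by (simp add: g_def)
  have cont: "continuous_on (closed_segment x y) g"
    if "closed_segment x y \<subseteq> closed_segment a b \<union> closed_segment b c \<union> closed_segment c a" for x y
    unfolding g_def using that seg hol
    by (intro continuous_intros holomorphic_on_imp_continuous_on[OF holomorphic_on_subset[OF holomorphic_deriv[OF hol open_UNIV]]]
        holomorphic_on_imp_continuous_on[OF holomorphic_on_subset[OF hol]]) auto
  have ints: "g contour_integrable_on linepath a b" "g contour_integrable_on linepath b c"
    "g contour_integrable_on linepath c a"
    by (auto intro!: contour_integrable_continuous_linepath cont)
  then show ?thesis
    using eq by (simp add: contour_integrable_joinI add.assoc)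
qed

section \<open>Zeros in a period parallelogram\<close>

locale period_basis =
  fixes l1 l2 :: complex
  assumes orient: "Im (cnj l1 * l2) > 0"
begin

text \<open>\<open>U\<close> and \<open>V\<close> are the real coordinates in the basis
  \<open>l1\<close>, \<open>l2\<close> by Cramer's rule, since Im (cnj a * b) is the determinant of
  a and b. The locale asks only for a positively oriented basis; that its members are periods enters
  lemma by lemma.\<close>

definition U :: "complex \<Rightarrow> real" where "U z = Im (cnj z * l2) / Im (cnj l1 * l2)"

definition V :: "complex \<Rightarrow> real" where "V z = Im (cnj l1 * z) / Im (cnj l1 * l2)"

lemma decomp: "z = of_real (U z) * l1 + of_real (V z) * l2"
proof -
  have ne: "Im (cnj l1 * l2) \<noteq> 0" using orient by simp
  have "of_real (Im (cnj l1 * l2)) * z = of_real (Im (cnj z * l2)) * l1 + of_real (Im (cnj l1 * z)) * l2"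
    by (simp add: complex_eq_iff algebra_simps)
  then show ?thesis using ne unfolding U_def V_def of_real_divide
    by (metis (no_types, lifting) add_divide_distrib nonzero_mult_div_cancel_left of_real_eq_0_iff times_divide_eq_left)
qed

lemma UV_linear [simp]:
  "U (x + y) = U x + U y" "V (x + y) = V x + V y"
  "U (x - y) = U x - U y" "V (x - y) = V x - V y"
  "U (of_real r * x) = r * U x" "V (of_real r * x) = r * V x"
  "U (r *\<^sub>R x) = r * U x" "V (r *\<^sub>R x) = r * V x"
  by (simp_all add: U_def V_def algebra_simps add_divide_distrib diff_divide_distrib)

lemma UV_basis [simp]: "U l1 = 1" "V l1 = 0" "U l2 = 0" "V l2 = 1"
  using orient by (simp_all add: U_def V_def)

text \<open>Countably many zeros rule out only countably many values of each coordinate of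
  \<open>a\<close>. The second coordinate is fixed before the first, as the condition for the
  diagonal U = V involves both.\<close>

lemma exists_base_point:
  assumes "countable Z"
  obtains a where "\<And>z. z \<in> Z \<Longrightarrow> U (z - a) \<notin> {0, 1} \<and> V (z - a) \<notin> {0, 1} \<and> U (z - a) \<noteq> V (z - a)"
proof -
  have unc: "uncountable (UNIV :: real set)" by (rule uncountable_UNIV_real)
  have "countable (V ` Z \<union> (\<lambda>z. V z - 1) ` Z)" using assms by simp
  then obtain \<beta> where \<beta>: "\<beta> \<notin> V ` Z \<union> (\<lambda>z. V z - 1) ` Z"
    using unc by (metis UNIV_eq_I)
  have "countable (U ` Z \<union> (\<lambda>z. U z - 1) ` Z \<union> (\<lambda>z. U z - V z + \<beta>) ` Z)" using assms by simp
  then obtain \<alpha> where \<alpha>: "\<alpha> \<notin> U ` Z \<union> (\<lambda>z. U z - 1) ` Z \<union> (\<lambda>z. U z - V z + \<beta>) ` Z"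
    using unc by (metis UNIV_eq_I)
  show ?thesis
    by (rule that[of "of_real \<alpha> * l1 + of_real \<beta> * l2"]) (use \<alpha> \<beta> in \<open>force simp: image_iff\<close>)
qed

text \<open>The parallelogram is cut along a diagonal, whose two integrals cancel. Quasi-periodicity
  changes the logarithmic derivative by the constant \<open>b1\<close> or \<open>b2\<close> between
  opposite sides, so these pairs contribute b1 * l2 and - b2 * l1. Zeros in the open parallelogram
  have coordinates that differ by less than 1.\<close>

lemma quasi_periodic_zero_count:
  fixes f :: "complex \<Rightarrow> complex"
  assumes hol: "f holomorphic_on UNIV" and nz: "f z0 \<noteq> 0"
    and q1: "\<And>s. f (s + l1) = exp (c1 + b1 * s) * f s"
    and q2: "\<And>s. f (s + l2) = exp (c2 + b2 * s) * f s"
  obtains P where "finite P" "\<And>p. p \<in> P \<Longrightarrow> f p = 0"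
    "\<And>p q. p \<in> P \<Longrightarrow> q \<in> P \<Longrightarrow> \<bar>U (p - q)\<bar> < 1 \<and> \<bar>V (p - q)\<bar> < 1"
    "2 * pi * \<i> * (\<Sum>p\<in>P. of_int (zorder f p)) = b1 * l2 - b2 * l1"
proof -
  obtain a where a: "\<And>z. f z = 0 \<Longrightarrow> U (z - a) \<notin> {0, 1} \<and> V (z - a) \<notin> {0, 1} \<and> U (z - a) \<noteq> V (z - a)"
    using exists_base_point[OF zeros_countable_entire[OF hol nz]] by auto
  define b where "b = a + l1"
  define c where "c = a + l1 + l2"
  define d where "d = a + l2"
  define g where "g = (\<lambda>z. deriv f z / f z)"
  define T1 where "T1 = {z \<in> interior (convex hull {a, b, c}). f z = 0}"
  define T2 where "T2 = {z \<in> interior (convex hull {a, c, d}). f z = 0}"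
  have UV: "U b = U a + 1" "V b = V a" "U c = U a + 1" "V c = V a + 1" "U d = U a" "V d = V a + 1"
    by (simp_all add: b_def c_def d_def)
  \<comment> \<open>Each side and the diagonal lies on one of the lines that the choice of
    \<open>a\<close> keeps free of zeros.\<close>
  have sg: "f z \<noteq> 0" if "z \<in> closed_segment a b \<or> z \<in> closed_segment b c \<or> z \<in> closed_segment c a
      \<or> z \<in> closed_segment a c \<or> z \<in> closed_segment c d \<or> z \<in> closed_segment d a
      \<or> z \<in> closed_segment d c \<or> z \<in> closed_segment a d" for z
  proof
    assume "f z = 0"
    from a[OF this] that show False
      by (auto simp: in_segment UV) (simp_all add: algebra_simps)
  qed
  have S1: "contour_integral (linepath a b) g + contour_integral (linepath b c) g
           + contour_integral (linepath c a) g = 2 * pi * \<i> * (\<Sum>p\<in>T1. of_int (zorder f p))"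
    unfolding g_def T1_def
    by (rule triangle_zero_count[OF hol nz]) (use sg orient in \<open>auto simp: b_def c_def algebra_simps\<close>)
  have S2: "contour_integral (linepath a c) g + contour_integral (linepath c d) g
           + contour_integral (linepath d a) g = 2 * pi * \<i> * (\<Sum>p\<in>T2. of_int (zorder f p))"
    unfolding g_def T2_def
    by (rule triangle_zero_count[OF hol nz]) (use sg orient in \<open>auto simp: d_def c_def algebra_simps\<close>)
  have cont: "continuous_on (closed_segment x y) g"
    if "\<And>z. z \<in> closed_segment x y \<Longrightarrow> f z \<noteq> 0" for x y
    unfolding g_def using that hol
    by (intro continuous_intros holomorphic_on_imp_continuous_on[OF holomorphic_on_subset[OF holomorphic_deriv[OF hol open_UNIV]]]
        holomorphic_on_imp_continuous_on[OF holomorphic_on_subset[OF hol]]) auto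
  have rev: "contour_integral (linepath c a) g = - contour_integral (linepath a c) g"
    "contour_integral (linepath c d) g = - contour_integral (linepath d c) g"
    "contour_integral (linepath d a) g = - contour_integral (linepath a d) g"
    using sg by (auto intro!: contour_integral_reverse_linepath cont)
  have df: "(f has_field_derivative deriv f s) (at s)" for s
    using hol by (simp add: holomorphic_derivI)
  have shift: "g (s + l) = g s + \<beta>" if q: "\<And>s. f (s + l) = exp (\<gamma> + \<beta> * s) * f s" and s: "f s \<noteq> 0"
    for l \<beta> \<gamma> s
  proof -
    have "((\<lambda>s. f (s + l)) has_field_derivative deriv f (s + l)) (at s)"
      using df[of "s + l"] by (simp add: DERIV_shift)
    moreover have "((\<lambda>s. exp (\<gamma> + \<beta> * s) * f s) has_field_derivative
        exp (\<gamma> + \<beta> * s) * (\<beta> * f s + deriv f s)) (at s)"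
      by (auto intro!: derivative_eq_intros df simp: algebra_simps)
    ultimately have "deriv f (s + l) = exp (\<gamma> + \<beta> * s) * (\<beta> * f s + deriv f s)"
      unfolding q by (rule DERIV_unique)
    then show ?thesis
      using s by (simp add: g_def q add_divide_distrib)
  qed
  have int_shift: "contour_integral (linepath (x + l) (y + l)) g = contour_integral (linepath x y) g + \<beta> * (y - x)"
    if q: "\<And>s. f (s + l) = exp (\<gamma> + \<beta> * s) * f s"
      and nzxy: "\<And>z. z \<in> closed_segment x y \<Longrightarrow> f z \<noteq> 0" for l \<beta> \<gamma> x y
  proof -
    have "contour_integral (linepath (x + l) (y + l)) g = contour_integral (linepath x y) (\<lambda>s. g (s + l))"
      by (simp add: contour_integral_integral linepath_def algebra_simps)
    also have "\<dots> = contour_integral (linepath x y) (\<lambda>s. g s + \<beta>)"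
      by (rule contour_integral_eq) (use shift[OF q] nzxy in auto)
    also have "\<dots> = contour_integral (linepath x y) g + contour_integral (linepath x y) (\<lambda>_. \<beta>)"
      by (rule contour_integral_add) (use nzxy in \<open>auto intro!: contour_integrable_continuous_linepath cont\<close>)
    finally show ?thesis by simp
  qed
  have I1: "contour_integral (linepath b c) g = contour_integral (linepath a d) g + b1 * l2"
    using int_shift[OF q1, of a d] sg by (simp add: b_def c_def d_def add_ac)
  have I2: "contour_integral (linepath d c) g = contour_integral (linepath a b) g + b2 * l1"
    using int_shift[OF q2, of a b] sg by (simp add: b_def c_def d_def add_ac)
  have fin: "finite T1" "finite T2"
  proof -
    have "compact (convex hull {a, b, c})" "compact (convex hull {a, c, d})"
      by (simp_all add: finite_imp_compact_convex_hull)
    note fin = this[THEN zeros_finite_entire[OF hol nz]]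
    show "finite T1"
      by (rule finite_subset[OF _ fin(1)]) (auto simp: T1_def dest: interior_subset[THEN subsetD])
    show "finite T2"
      by (rule finite_subset[OF _ fin(2)]) (auto simp: T2_def dest: interior_subset[THEN subsetD])
  qed
  \<comment> \<open>The triangle itself satisfies only the weak inequalities; the choice of
    \<open>a\<close> makes them strict at zeros. Comparison with the mirrored chain for
    \<open>T2\<close> shows that the two zero sets are disjoint.\<close>
  have T1: "0 < V (z - a) \<and> V (z - a) < U (z - a) \<and> U (z - a) < 1" if "z \<in> T1" for z
  proof -
    have "z \<in> convex hull {a, b, c}" "f z = 0"
      using that by (auto simp: T1_def dest: interior_subset[THEN subsetD])
    then obtain u v w where uvw: "u \<ge> 0" "v \<ge> 0" "w \<ge> 0" "u + v + w = 1"
      and z: "z = u *\<^sub>R a + v *\<^sub>R b + w *\<^sub>R c"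
      unfolding convex_hull_3 by auto
    have u: "u = 1 - v - w" using uvw by simp
    have "V (z - a) = w" "U (z - a) = v + w"
      unfolding z u by (simp_all add: UV algebra_simps)
    with a[OF \<open>f z = 0\<close>] uvw show ?thesis by auto
  qed
  have T2: "0 < U (z - a) \<and> U (z - a) < V (z - a) \<and> V (z - a) < 1" if "z \<in> T2" for z
  proof -
    have "z \<in> convex hull {a, c, d}" "f z = 0"
      using that by (auto simp: T2_def dest: interior_subset[THEN subsetD])
    then obtain u v w where uvw: "u \<ge> 0" "v \<ge> 0" "w \<ge> 0" "u + v + w = 1"
      and z: "z = u *\<^sub>R a + v *\<^sub>R c + w *\<^sub>R d"
      unfolding convex_hull_3 by auto
    have u: "u = 1 - v - w" using uvw by simp
    have "V (z - a) = v + w" "U (z - a) = v"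
      unfolding z u by (simp_all add: UV algebra_simps)
    with a[OF \<open>f z = 0\<close>] uvw show ?thesis by auto
  qed
  show ?thesis
  proof (rule that[of "T1 \<union> T2"])
    show "finite (T1 \<union> T2)" using fin by simp
    show "f p = 0" if "p \<in> T1 \<union> T2" for p
      using that by (auto simp: T1_def T2_def)
    show "\<bar>U (p - q)\<bar> < 1 \<and> \<bar>V (p - q)\<bar> < 1" if "p \<in> T1 \<union> T2" "q \<in> T1 \<union> T2" for p q
      using that T1[of p] T1[of q] T2[of p] T2[of q] by auto
    have "T1 \<inter> T2 = {}" using T1 T2 by fastforce
    then have "2 * pi * \<i> * (\<Sum>p\<in>T1 \<union> T2. of_int (zorder f p))
        = 2 * pi * \<i> * (\<Sum>p\<in>T1. of_int (zorder f p)) + 2 * pi * \<i> * (\<Sum>p\<in>T2. of_int (zorder f p))"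
      by (simp add: sum.union_disjoint fin algebra_simps)
    also have "\<dots> = b1 * l2 - b2 * l1"
      unfolding S1[symmetric] S2[symmetric] rev I1 I2 by (simp add: algebra_simps)
    finally show "2 * pi * \<i> * (\<Sum>p\<in>T1 \<union> T2. of_int (zorder f p)) = b1 * l2 - b2 * l1" .
  qed
qed

end

section \<open>Reduced bases and lattice points in balls\<close>

text \<open>The points of \<open>A\<close> that are no longer than \<open>x\<close> form a finite
  nonempty set, and a shortest one among them is shortest in all of \<open>A\<close>.\<close>

lemma exists_min_norm:
  fixes M :: "'a::real_normed_vector set"
  assumes fin: "\<And>R. finite (M \<inter> cball 0 R)" and A: "A \<subseteq> M" "x \<in> A"
  obtains y where "y \<in> A" "\<And>z. z \<in> A \<Longrightarrow> norm y \<le> norm z"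
proof -
  let ?B = "A \<inter> cball 0 (norm x)"
  have "finite ?B" using fin[of "norm x"] A(1) by (auto elim!: finite_subset[rotated])
  moreover have "?B \<noteq> {}" using A by auto
  ultimately obtain y where y: "y \<in> ?B" "\<And>z. z \<in> ?B \<Longrightarrow> norm y \<le> norm z"
    using ex_is_arg_min_if_finite[of ?B norm] by (metis is_arg_min_linorder)
  show ?thesis
  proof (rule that[of y])
    show "norm y \<le> norm z" if "z \<in> A" for z
      using y that by (cases "z \<in> ?B") auto
  qed (use y in auto)
qed

lemma cnj_parallel:
  assumes "a \<noteq> 0" "Im (cnj a * b) = 0"
  shows "b \<in> range (\<lambda>r. of_real r * a)"
proof -
  have ne: "(Re a)\<^sup>2 + (Im a)\<^sup>2 \<noteq> 0" using assms(1) by (simp add: complex_eq_iff)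
  have "cnj a * b = of_real (Re (cnj a * b))"
    using assms(2) by (simp add: complex_eq_iff)
  then have "a * cnj a * b = of_real (Re (cnj a * b)) * a"
    by (simp add: mult_ac)
  then have "of_real ((Re a)\<^sup>2 + (Im a)\<^sup>2) * b = of_real (Re (cnj a * b)) * a"
    by (simp only: complex_mult_cnj)
  then have "b = of_real (Re (cnj a * b) / ((Re a)\<^sup>2 + (Im a)\<^sup>2)) * a"
    using ne unfolding of_real_divide
    by (metis nonzero_mult_div_cancel_left of_real_eq_0_iff times_divide_eq_left)
  then show ?thesis by blast
qed

lemma subgroup_of_int_mult:
  fixes M :: "complex set"
  assumes "0 \<in> M" "\<And>x y. x \<in> M \<Longrightarrow> y \<in> M \<Longrightarrow> x - y \<in> M" "x \<in> M"
  shows "of_int k * x \<in> M"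
proof -
  have minus: "- y \<in> M" if "y \<in> M" for y using assms(1,2) that by (metis diff_0)
  have plus: "y + z \<in> M" if "y \<in> M" "z \<in> M" for y z
    using assms(2)[OF that(1) minus[OF that(2)]] by simp
  have nat: "of_nat n * x \<in> M" for n
    by (induction n) (use assms plus in \<open>auto simp: algebra_simps\<close>)
  show ?thesis
    by (cases k rule: int_cases2) (use nat minus in \<open>auto simp: mult_minus_left\<close>)
qed

text \<open>Gauss reduction: \<open>l1\<close> is a shortest nonzero period, and \<open>l2\<close>
  is, up to a sign fixing the orientation, a shortest period off the real line through
  \<open>l1\<close>. The last conclusion says that no two distinct points of an open period
  parallelogram are congruent modulo \<open>M\<close>.\<close>

lemma reduced_period_basis:
  fixes M :: "complex set"
  assumes M: "0 \<in> M" "\<And>x y. x \<in> M \<Longrightarrow> y \<in> M \<Longrightarrow> x - y \<in> M"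
    and fin: "\<And>R. finite (M \<inter> cball 0 R)"
    and off_line: "\<And>u. \<not> M \<subseteq> range (\<lambda>r. of_real r * u)"
  obtains l1 l2 where "l1 \<in> M" "l2 \<in> M" "l1 \<noteq> 0" "period_basis l1 l2"
    "(cmod l1)\<^sup>2 \<le> 2 * Im (cnj l1 * l2)"
    "\<And>u. u \<in> M \<Longrightarrow> \<bar>period_basis.U l1 l2 u\<bar> < 1 \<Longrightarrow> \<bar>period_basis.V l1 l2 u\<bar> < 1 \<Longrightarrow> u = 0"
proof -
  have minus: "- y \<in> M" if "y \<in> M" for y using M that by (metis diff_0)
  have plus: "y + z \<in> M" if "y \<in> M" "z \<in> M" for y z
    using M(2)[OF that(1) minus[OF that(2)]] by simp
  obtain x0 where "x0 \<in> M - {0}" using off_line[of 0] by auto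
  from exists_min_norm[OF fin Diff_subset this]
  obtain l1 where l1: "l1 \<in> M" "l1 \<noteq> 0" and min1: "\<And>z. z \<in> M - {0} \<Longrightarrow> norm l1 \<le> norm z"
    by (metis DiffD1 DiffD2 singletonI)
  let ?L = "range (\<lambda>r. of_real r * l1)"
  obtain x1 where "x1 \<in> M - ?L" using off_line[of l1] by auto
  from exists_min_norm[OF fin Diff_subset this]
  obtain m where m: "m \<in> M" "m \<notin> ?L" and min2: "\<And>z. z \<in> M - ?L \<Longrightarrow> norm m \<le> norm z"
    by (metis DiffD1 DiffD2)
  have "Im (cnj l1 * m) \<noteq> 0" using cnj_parallel[OF l1(2)] m by blast
  define l2 where "l2 = (if Im (cnj l1 * m) > 0 then m else - m)"
  have "l2 \<in> M" using m minus by (simp add: l2_def)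
  have pos: "Im (cnj l1 * l2) > 0"
    using \<open>Im (cnj l1 * m) \<noteq> 0\<close> by (auto simp: l2_def)
  have min2: "norm l2 \<le> norm z" if "z \<in> M" "z \<notin> ?L" for z
    using min2 that by (simp add: l2_def)
  have off: "z \<notin> ?L" if "Im (cnj l1 * z) \<noteq> 0" for z
    using that by (auto simp: mult.assoc)
  interpret period_basis l1 l2 by standard (rule pos)
  define n1 where "n1 = (cmod l1)\<^sup>2"
  define n2 where "n2 = (cmod l2)\<^sup>2"
  define R where "R = Re (cnj l1 * l2)"
  have "n1 > 0" using l1 by (simp add: n1_def)
  have "l2 \<noteq> 0" using pos by auto
  then have n12: "n1 \<le> n2"
    unfolding n1_def n2_def using min1 \<open>l2 \<in> M\<close> by (intro power_mono) auto
  have comb: "(cmod (of_real r * l1 + of_real s * l2))\<^sup>2 = r\<^sup>2 * n1 + s\<^sup>2 * n2 + 2 * r * s * R" for r s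
    unfolding n1_def n2_def R_def cmod_power2 by (simp add: power2_eq_square algebra_simps)
  \<comment> \<open>Both competitors lie off the line through \<open>l1\<close>, so minimality of
    \<open>l2\<close> applies. Expanding the squares bounds the inner product \<open>R\<close> by
    half of \<open>n1\<close>.\<close>
  have "norm l2 \<le> norm (l2 + l1)" "norm l2 \<le> norm (l2 - l1)"
    using pos l1 \<open>l2 \<in> M\<close> plus M(2) by (auto intro!: min2 off simp: algebra_simps)
  then have "n2 \<le> (cmod (l2 + l1))\<^sup>2" "n2 \<le> (cmod (l2 - l1))\<^sup>2"
    by (simp_all add: n2_def power_mono)
  then have R: "\<bar>R\<bar> \<le> n1 / 2"
    using comb[of 1 1] comb[of "-1" 1] by (simp add: add.commute)
  \<comment> \<open>Lagrange's identity. With n1 \<le> n2 and the bound on \<open>R\<close>, the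
    squared area is at least 3/4 of n1^2; only 1/4 is kept.\<close>
  have "R\<^sup>2 + (Im (cnj l1 * l2))\<^sup>2 = n1 * n2"
    unfolding n1_def n2_def R_def cmod_power2 by (simp add: power2_eq_square algebra_simps)
  moreover have "R\<^sup>2 \<le> (n1 / 2)\<^sup>2" using power_mono[OF R, of 2] by simp
  moreover have "n1\<^sup>2 \<le> n1 * n2" using n12 \<open>n1 > 0\<close> by (simp add: power2_eq_square)
  ultimately have "(n1 / 2)\<^sup>2 \<le> (Im (cnj l1 * l2))\<^sup>2"
    using zero_le_power2[of n1] unfolding power_divide by (simp only: power2_eq_square[of "2::real"])
  then have short: "n1 \<le> 2 * Im (cnj l1 * l2)"
    using power2_le_imp_le[OF _ less_imp_le[OF pos], of "n1 / 2"] by linarith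
  \<comment> \<open>Rounding the coordinates of \<open>u\<close> leaves a period \<open>u'\<close>
    with coordinates at most 1/2, hence of squared length at most 3/4 of \<open>n2\<close>.
    Minimality of \<open>l2\<close> puts \<open>u'\<close> on the line through \<open>l1\<close>;
    there its squared length is at most 1/4 of \<open>n1\<close>, so minimality of \<open>l1\<close>
    makes it 0. Thus \<open>u\<close> has integer coordinates of absolute value below 1.\<close>
  have separated: "u = 0" if u: "u \<in> M" "\<bar>U u\<bar> < 1" "\<bar>V u\<bar> < 1" for u
  proof -
    define i where "i = round (U u)"
    define j where "j = round (V u)"
    define u' where "u' = u - of_int i * l1 - of_int j * l2"
    have "u' \<in> M"
      unfolding u'_def
      by (intro M(2) u(1) subgroup_of_int_mult[OF M l1(1)] subgroup_of_int_mult[OF M \<open>l2 \<in> M\<close>])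
    have ofint: "(of_int k :: complex) = of_real (of_int k)" for k by simp
    have U': "U u' = U u - i" and V': "V u' = V u - j"
      unfolding u'_def ofint by (simp_all del: of_real_of_int_eq)
    have half: "\<bar>U u'\<bar> \<le> 1 / 2" "\<bar>V u'\<bar> \<le> 1 / 2"
      using of_int_round_abs_le[of "U u"] of_int_round_abs_le[of "V u"]
      unfolding U' V' i_def j_def by (simp_all add: abs_minus_commute)
    have nu: "(cmod u')\<^sup>2 = (U u')\<^sup>2 * n1 + (V u')\<^sup>2 * n2 + 2 * U u' * V u' * R"
      using comb[of "U u'" "V u'"] decomp[of u'] by simp
    have sq: "(U u')\<^sup>2 \<le> 1 / 4" "(V u')\<^sup>2 \<le> 1 / 4"
      using power_mono[OF half(1), of 2] power_mono[OF half(2), of 2] by (simp_all add: power_divide)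
    have "\<bar>U u' * V u' * R\<bar> \<le> (1 / 2) * (1 / 2) * (n1 / 2)"
      unfolding abs_mult using half R by (intro mult_mono) auto
    then have "2 * U u' * V u' * R \<le> n1 / 4" by (simp add: abs_le_iff mult.assoc)
    then have "(cmod u')\<^sup>2 \<le> 1 / 4 * n1 + 1 / 4 * n2 + n1 / 4"
      unfolding nu using mult_right_mono[OF sq(1), of n1] mult_right_mono[OF sq(2), of n2] \<open>n1 > 0\<close> n12
      by linarith
    also have "\<dots> < n2" using n12 \<open>n1 > 0\<close> by simp
    finally have "cmod u' < cmod l2"
      unfolding n2_def by (rule power2_less_imp_less) simp
    then have "u' \<in> ?L" using min2[OF \<open>u' \<in> M\<close>] by linarith
    then have "V u' = 0" by (auto simp del: of_real_mult)
    then have "(cmod u')\<^sup>2 \<le> 1 / 4 * n1"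
      unfolding nu using mult_right_mono[OF sq(1), of n1] \<open>n1 > 0\<close> by simp
    then have "cmod u' < cmod l1"
      using power2_less_imp_less[of "cmod u'" "cmod l1"] \<open>n1 > 0\<close> unfolding n1_def by simp
    then have "u' = 0" using min1[of u'] \<open>u' \<in> M\<close> by fastforce
    then have "U u' = 0" "V u' = 0" by (simp_all add: U_def V_def)
    then have "U u = i" "V u = j" using U' V' by simp_all
    then have "U u = 0" "V u = 0" using u by auto
    then show "u = 0" using decomp[of u] by simp
  qed
  show ?thesis
    by (rule that[of l1 l2])
      (use l1 \<open>l2 \<in> M\<close> short separated in \<open>auto simp: n1_def intro: period_basis_axioms\<close>)
qed

text \<open>Packing by volume: the balls of radius \<delta>/2 around the points are disjoint and lie
  in the ball of radius R + \<delta>/2.\<close>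

lemma separated_card_le:
  fixes X :: "'a::euclidean_space set"
  assumes sep: "\<And>x y. x \<in> X \<Longrightarrow> y \<in> X \<Longrightarrow> x \<noteq> y \<Longrightarrow> \<delta> \<le> dist x y" and "\<delta> > 0"
    and bd: "X \<subseteq> cball 0 R" and "R \<ge> 0" and fin: "finite X"
  shows "real (card X) \<le> (1 + 2 * R / \<delta>) ^ DIM('a)"
proof -
  define v where "v = unit_ball_vol (real DIM('a))"
  have "v > 0" by (simp add: v_def)
  have disj: "disjoint_family_on (\<lambda>x. ball x (\<delta> / 2)) X"
    unfolding disjoint_family_on_def
  proof (intro ballI impI)
    fix x y assume "x \<in> X" "y \<in> X" "x \<noteq> y"
    then show "ball x (\<delta> / 2) \<inter> ball y (\<delta> / 2) = {}"
      using sep[of x y] by (intro disjoint_ballI) auto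
  qed
  have "real (card X) * (v * (\<delta> / 2) ^ DIM('a)) = (\<Sum>x\<in>X. measure lborel (ball x (\<delta> / 2)))"
    using \<open>\<delta> > 0\<close> by (simp add: content_ball v_def)
  also have "\<dots> = measure lborel (\<Union>x\<in>X. ball x (\<delta> / 2))"
    by (rule measure_finite_Union[symmetric])
      (use fin disj emeasure_lborel_ball_finite in \<open>auto simp: less_le\<close>)
  also have "\<dots> \<le> measure lborel (ball (0::'a) (R + \<delta> / 2))"
  proof (rule measure_mono_fmeasurable)
    show "(\<Union>x\<in>X. ball x (\<delta> / 2)) \<subseteq> ball 0 (R + \<delta> / 2)"
    proof safe
      fix x y assume "x \<in> X" "y \<in> ball x (\<delta> / 2)"
      then have "norm x \<le> R" "dist x y < \<delta> / 2" using bd by auto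
      then show "y \<in> ball 0 (R + \<delta> / 2)"
        using dist_triangle[of 0 y x] by (simp add: dist_norm)
    qed
  qed (auto intro!: fmeasurableI emeasure_lborel_ball_finite borel_open open_UN)
  also have "\<dots> = v * (R + \<delta> / 2) ^ DIM('a)"
    using \<open>\<delta> > 0\<close> \<open>R \<ge> 0\<close> by (simp add: content_ball v_def)
  finally have "real (card X) * (\<delta> / 2) ^ DIM('a) \<le> (R + \<delta> / 2) ^ DIM('a)"
    using \<open>v > 0\<close> by (simp add: mult_ac)
  then have "real (card X) \<le> ((R + \<delta> / 2) / (\<delta> / 2)) ^ DIM('a)"
    using \<open>\<delta> > 0\<close> by (simp only: power_divide) (simp add: field_simps)
  also have "(R + \<delta> / 2) / (\<delta> / 2) = 1 + 2 * R / \<delta>"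
    using \<open>\<delta> > 0\<close> by (simp add: field_simps)
  finally show ?thesis .
qed

text \<open>The packing bound is the same for all finite subsets, and such a uniform bound forces
  finiteness.\<close>

lemma separated_finite_card_le:
  fixes X :: "'a::euclidean_space set"
  assumes sep: "\<And>x y. x \<in> X \<Longrightarrow> y \<in> X \<Longrightarrow> x \<noteq> y \<Longrightarrow> \<delta> \<le> dist x y" and "\<delta> > 0" "R \<ge> 0"
  shows "finite (X \<inter> cball 0 R)" "real (card (X \<inter> cball 0 R)) \<le> (1 + 2 * R / \<delta>) ^ DIM('a)"
proof -
  have le: "real (card Y) \<le> (1 + 2 * R / \<delta>) ^ DIM('a)" if "finite Y" "Y \<subseteq> X \<inter> cball 0 R" for Y
    using that by (intro separated_card_le[OF _ assms(2) _ assms(3)] sep) auto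
  have "card Y \<le> nat \<lceil>(1 + 2 * R / \<delta>) ^ DIM('a)\<rceil>" if "Y \<subseteq> X \<inter> cball 0 R" "finite Y" for Y
    using le[OF that(2,1)] by linarith
  from finite_if_finite_subsets_card_bdd[of "X \<inter> cball 0 R", OF this] show "finite (X \<inter> cball 0 R)"
    by simp
  then show "real (card (X \<inter> cball 0 R)) \<le> (1 + 2 * R / \<delta>) ^ DIM('a)"
    by (intro le) auto
qed

text \<open>Discreteness alone gives an isolation radius that depends on the point. In a subgroup,
  passing to differences makes the radius at 0 serve everywhere.\<close>

lemma lattice_separated:
  assumes "lattice_in W \<Lambda>"
  shows "\<exists>\<delta>>0. \<forall>x\<in>\<Lambda>. \<forall>y\<in>\<Lambda>. x \<noteq> y \<longrightarrow> \<delta> \<le> dist x y"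
proof -
  have "0 isolated_in \<Lambda>" using assms by (auto simp: lattice_in_def dest: discreteD)
  then obtain \<delta> where \<delta>: "\<delta> > 0" "\<And>x. x \<in> \<Lambda> \<Longrightarrow> dist 0 x < \<delta> \<Longrightarrow> x = 0"
    unfolding isolated_in_dist_Ex_iff by blast
  show ?thesis
  proof (intro exI[of _ \<delta>] conjI ballI impI \<delta>(1))
    fix x y assume xy: "x \<in> \<Lambda>" "y \<in> \<Lambda>" "x \<noteq> y"
    then have "x - y \<in> \<Lambda>" using assms by (auto simp: lattice_in_def)
    then show "\<delta> \<le> dist x y" using \<delta>(2)[of "x - y"] xy by (fastforce simp: dist_norm norm_minus_commute not_less)
  qed
qed

section \<open>Hermitian forms and subtori\<close>

lemma norm_vector_smult:
  fixes x :: "'a::real_normed_field ^ 'n"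
  shows "norm (c *s x) = norm c * norm x"
  by (simp add: norm_vec_def norm_mult L2_set_right_distrib)

lemma scaleR_eq_vector_smult: "r *\<^sub>R (x :: complex ^ 'n) = of_real r *s x"
  unfolding vec_eq_iff vector_scaleR_component vector_smult_component by (simp add: scaleR_conv_of_real)

lemma hermitian_form_left:
  assumes "hermitian_form H"
  shows "H (x + y) z = H x z + H y z" "H (c *s x) y = c * H x y"
  using assms unfolding hermitian_form_def by blast+

lemma hermitian_form_right:
  assumes "hermitian_form H"
  shows "H x (y + z) = H x y + H x z" "H x (c *s y) = cnj c * H x y"
  using assms unfolding hermitian_form_def by (metis complex_cnj_add, metis complex_cnj_mult)

lemma hermitian_form_self_scale:
  assumes "hermitian_form H"
  shows "Re (H (c *s x) (c *s x)) = (cmod c)\<^sup>2 * Re (H x x)"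
proof -
  have "H (c *s x) (c *s x) = c * cnj c * H x x"
    by (simp add: hermitian_form_left[OF assms] hermitian_form_right[OF assms] mult_ac)
  then show ?thesis
    by (simp add: complex_norm_square[symmetric])
qed

lemma bounded_bilinear_hermitian_form:
  assumes "hermitian_form H"
  shows "bounded_bilinear H"
proof -
  have "bilinear H"
    unfolding bilinear_def
    by (auto intro!: linearI simp: hermitian_form_left[OF assms] hermitian_form_right[OF assms]
        scaleR_eq_vector_smult scaleR_conv_of_real)
  then show ?thesis by (simp add: bilinear_conv_bounded_bilinear)
qed

text \<open>The minimum over the compact unit sphere is positive, and homogeneity of degree 2
  extends the bound to all vectors. This converts bounds on H-length into bounds on Euclidean
  length.\<close>

lemma polarization_coercive:
  assumes "polarization \<Lambda> H"
  obtains c where "c > 0" "\<And>x. c * (norm x)\<^sup>2 \<le> Re (H x x)"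
proof -
  have herm: "hermitian_form H" and pos: "\<And>x. x \<noteq> 0 \<Longrightarrow> Re (H x x) > 0"
    using assms by (auto simp: polarization_def)
  let ?S = "sphere (0 :: complex ^ 2) 1"
  have "continuous_on ?S (\<lambda>x. Re (H x x))"
    by (intro continuous_intros bounded_bilinear.continuous_on[OF bounded_bilinear_hermitian_form[OF herm]])
  from continuous_attains_inf[OF compact_sphere _ this]
  obtain e where e: "e \<in> ?S" "\<And>x. x \<in> ?S \<Longrightarrow> Re (H e e) \<le> Re (H x x)"
    by (auto simp del: mem_sphere)
  show ?thesis
  proof (rule that[of "Re (H e e)"])
    show "Re (H e e) > 0" using e(1) by (intro pos) auto
    fix x
    show "Re (H e e) * (norm x)\<^sup>2 \<le> Re (H x x)"
    proof (cases "x = 0")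
      case True
      then show ?thesis using hermitian_form_self_scale[OF herm, of 0 0] by simp
    next
      case False
      define u where "u = of_real (1 / norm x) *s x"
      have "u \<in> ?S" using False by (simp add: u_def norm_vector_smult norm_divide)
      then have "Re (H e e) \<le> (cmod (of_real (1 / norm x)))\<^sup>2 * Re (H x x)"
        using e(2) hermitian_form_self_scale[OF herm] unfolding u_def by metis
      then show ?thesis using False by (simp add: norm_divide power_divide field_simps)
    qed
  qed
qed

lemma holomorphic_C2_on_line:
  assumes "holomorphic_C2 \<theta>"
  shows "(\<lambda>s. \<theta> (x + s *s w)) holomorphic_on UNIV"
proof -
  have "\<exists>d. ((\<lambda>s. \<theta> (x + s *s w)) has_field_derivative d) (at s)" for s
  proof -
    obtain D where D: "(\<theta> has_derivative D) (at (x + s *s w))" "\<And>c v. D (c *s v) = c * D v"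
      using assms unfolding holomorphic_C2_def by blast
    have "linear (\<lambda>h. h *s w)"
      by (rule linearI) (simp_all add: vec.scale_left_distrib scaleR_eq_vector_smult scaleR_conv_of_real)
    then have "bounded_linear (\<lambda>h. h *s w)" by (simp add: linear_conv_bounded_linear)
    then have "((\<lambda>s. x + s *s w) has_derivative (\<lambda>h. h *s w)) (at s)"
      by (auto intro!: derivative_eq_intros bounded_linear_imp_has_derivative)
    from has_derivative_compose[OF this D(1)]
    have "((\<lambda>s. \<theta> (x + s *s w)) has_derivative (\<lambda>h. D w * h)) (at s)"
      by (simp add: D(2) mult.commute)
    then show ?thesis unfolding has_field_derivative_def by blast
  qed
  then show ?thesis by (simp add: holomorphic_on_def field_differentiable_def)
qed

lemma lattice_closed:
  assumes "lattice_in W \<Lambda>"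
  shows "0 \<in> \<Lambda>" "x \<in> \<Lambda> \<Longrightarrow> y \<in> \<Lambda> \<Longrightarrow> x - y \<in> \<Lambda>" "x \<in> \<Lambda> \<Longrightarrow> - x \<in> \<Lambda>"
    "x \<in> \<Lambda> \<Longrightarrow> y \<in> \<Lambda> \<Longrightarrow> x + y \<in> \<Lambda>"
proof -
  have *: "0 \<in> \<Lambda>" "\<And>x y. x \<in> \<Lambda> \<Longrightarrow> y \<in> \<Lambda> \<Longrightarrow> x - y \<in> \<Lambda>"
    using assms by (auto simp: lattice_in_def)
  show "0 \<in> \<Lambda>" "x \<in> \<Lambda> \<Longrightarrow> y \<in> \<Lambda> \<Longrightarrow> x - y \<in> \<Lambda>" using * by auto
  show m: "- x \<in> \<Lambda>" if "x \<in> \<Lambda>" for x using *(2)[OF *(1) that] by simp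
  show "x \<in> \<Lambda> \<Longrightarrow> y \<in> \<Lambda> \<Longrightarrow> x + y \<in> \<Lambda>" using *(2)[OF _ m, of x y] by simp
qed

lemma lattice_finite_cball:
  fixes \<Lambda> :: "'a::euclidean_space set"
  assumes "lattice_in W \<Lambda>"
  shows "finite (\<Lambda> \<inter> cball 0 R)"
proof -
  obtain \<delta> where "\<delta> > 0" "\<And>x y. x \<in> \<Lambda> \<Longrightarrow> y \<in> \<Lambda> \<Longrightarrow> x \<noteq> y \<Longrightarrow> \<delta> \<le> dist x y"
    using lattice_separated[OF assms] by blast
  then have "finite (\<Lambda> \<inter> cball 0 \<bar>R\<bar>)"
    by (intro separated_finite_card_le(1)) auto
  then show ?thesis by (rule finite_subset[rotated]) auto
qed

lemma lattice_countable:
  fixes \<Lambda> :: "'a::euclidean_space set"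
  assumes "lattice_in W \<Lambda>"
  shows "countable \<Lambda>"
proof -
  have "\<Lambda> = (\<Union>n. \<Lambda> \<inter> cball 0 (real n))"
    by (auto intro: real_arch_simple)
  also have "countable \<dots>"
    by (simp only: countable_UN countableI_type countable_finite lattice_finite_cball[OF assms])
  finally show ?thesis .
qed

section \<open>Points of the torus and tangent lines of subtori\<close>

lemma mem_torus_proj: "z \<in> torus_proj \<Lambda> y \<longleftrightarrow> z - y \<in> \<Lambda>"
  unfolding torus_proj_def image_iff by (metis add_diff_cancel_left' add.commute diff_add_cancel)

lemma torus_proj_eq_iff:
  assumes "lattice_in W \<Lambda>"
  shows "torus_proj \<Lambda> y = torus_proj \<Lambda> z \<longleftrightarrow> y - z \<in> \<Lambda>"
proof
  assume "torus_proj \<Lambda> y = torus_proj \<Lambda> z"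
  then have "y \<in> torus_proj \<Lambda> z"
    using lattice_closed(1)[OF assms] by (metis mem_torus_proj diff_self)
  then show "y - z \<in> \<Lambda>" by (simp add: mem_torus_proj)
next
  assume yz: "y - z \<in> \<Lambda>"
  have "u - y \<in> \<Lambda> \<longleftrightarrow> u - z \<in> \<Lambda>" for u
    using lattice_closed(2)[OF assms _ yz, of "u - z"] lattice_closed(4)[OF assms _ yz, of "u - y"] by auto
  then show "torus_proj \<Lambda> y = torus_proj \<Lambda> z" by (auto simp: mem_torus_proj)
qed

text \<open>If the complex line of \<open>w\<close> projects into the curve, each real multiple of
  \<open>w\<close> differs from a vector of \<open>W\<close> by a lattice vector. There are
  uncountably many multiples but countably many lattice vectors, so two multiples share one; their
  difference is a nonzero multiple of \<open>w\<close> in \<open>W\<close>.\<close>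

lemma tangent_line_torus_proj:
  assumes lat: "lattice_in V \<Lambda>" and W: "vec.subspace W"
  shows "tangent_line \<Lambda> (torus_proj \<Lambda> ` W) = W"
proof
  show "W \<subseteq> tangent_line \<Lambda> (torus_proj \<Lambda> ` W)"
    using W by (auto simp: tangent_line_def vec.subspace_def)
  show "tangent_line \<Lambda> (torus_proj \<Lambda> ` W) \<subseteq> W"
  proof
    fix w assume "w \<in> tangent_line \<Lambda> (torus_proj \<Lambda> ` W)"
    then have "\<forall>c. \<exists>u\<in>W. c *s w - u \<in> \<Lambda>"
      by (auto simp: tangent_line_def image_iff torus_proj_eq_iff[OF lat])
    then obtain u where u: "\<And>c. u c \<in> W" "\<And>c. c *s w - u c \<in> \<Lambda>" by metis
    define g where "g = (\<lambda>r::real. of_real r *s w - u (of_real r))"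
    have "countable (range g)"
      by (rule countable_subset[OF _ lattice_countable[OF lat]]) (use u in \<open>auto simp: g_def\<close>)
    then have "\<not> inj g"
      using uncountable_UNIV_real countable_image_inj_on by blast
    then obtain r s where rs: "r \<noteq> s" "g r = g s" by (auto simp: inj_def)
    define c where "c = complex_of_real (r - s)"
    have "c \<noteq> 0" using rs by (simp add: c_def)
    have "c *s w = u (of_real r) - u (of_real s)"
      using rs(2) by (simp add: g_def c_def vec.scale_left_diff_distrib algebra_simps)
    then have "c *s w \<in> W" using u W vec.subspace_diff by metis
    then have "inverse c *s (c *s w) \<in> W" by (rule vec.subspace_scale[OF W])
    moreover have "inverse c *s (c *s w) = w" using \<open>c \<noteq> 0\<close> by (simp add: vec_eq_iff)
    ultimately show "w \<in> W" by simp
  qed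
qed

lemma vec_subspace_dim_1:
  fixes W :: "('a::field ^ 'n) set"
  assumes "vec.subspace W" "vec.dim W = 1" "w \<in> W" "w \<noteq> 0"
  shows "W = range (\<lambda>s. s *s w)"
proof -
  have "vec.span {w} = W"
  proof (rule vec.subspace_dim_equal)
    show "vec.span {w} \<subseteq> W" using assms by (simp add: vec.span_minimal)
    show "vec.dim (vec.span {w}) \<ge> vec.dim W"
      using assms by (simp add: vec.dim_eq_card_independent)
  qed (use assms in \<open>simp_all add: vec.subspace_span\<close>)
  then show ?thesis by (simp add: vec.span_singleton)
qed

section \<open>The degree of an elliptic curve\<close>

locale elliptic_curve_in_torus =
  fixes \<Lambda> :: "(complex ^ 2) set" and H :: "complex ^ 2 \<Rightarrow> complex ^ 2 \<Rightarrow> complex"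
    and \<theta> :: "complex ^ 2 \<Rightarrow> complex" and W :: "(complex ^ 2) set"
  assumes lat: "lattice_in UNIV \<Lambda>"
    and pol: "polarization \<Lambda> H"
    and theta: "theta_function \<Lambda> H \<theta>"
    and W: "vec.subspace W" "vec.dim W = 1" "lattice_in W (W \<inter> \<Lambda>)"
begin

definition F where "F = torus_proj \<Lambda> ` W"

text \<open>\<open>w\<close> and \<open>x\<close> are literally the choices made in
  \<open>local_mult\<close> and \<open>curve_degree\<close>, so that the degree unfolds to orders of
  the one-variable function \<open>f\<close>.\<close>

definition w where "w = tangent_vector \<Lambda> F"

definition x where "x = (SOME x. proper_translate \<theta> x F)"

definition f where "f s = \<theta> (x + s *s w)"

text \<open>In the coordinate along \<open>w\<close> the curve is the complex plane modulo the
  period lattice \<open>M\<close>, and \<open>\<kappa>\<close> is the covering map.\<close>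

definition M where "M = {s. s *s w \<in> \<Lambda>}"

definition \<kappa> where "\<kappa> s = torus_proj \<Lambda> (s *s w)"

lemma herm: "hermitian_form H"
  using pol by (simp add: polarization_def)

lemma w: "w \<in> W" "w \<noteq> 0"
proof -
  have "\<exists>w. w \<in> W \<and> w \<noteq> 0"
  proof (rule ccontr)
    assume "\<not> ?thesis"
    then have "W \<subseteq> {0}" by auto
    then have "vec.dim W = 0" by (simp add: vec.dim_eq_0)
    with W show False by simp
  qed
  from someI_ex[OF this] show "w \<in> W" "w \<noteq> 0"
    by (simp_all add: w_def F_def tangent_vector_def tangent_line_torus_proj[OF lat W(1)])
qed

lemma mem_W: "y \<in> W \<longleftrightarrow> (\<exists>s. y = s *s w)"
  using vec_subspace_dim_1[OF W(1,2) w] by blast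

lemma F_eq: "F = range \<kappa>"
  unfolding F_def \<kappa>_def[abs_def] by (auto simp: mem_W)

lemma M_closed: "0 \<in> M" "a \<in> M \<Longrightarrow> b \<in> M \<Longrightarrow> a - b \<in> M"
  using lattice_closed[OF lat] by (simp_all add: M_def vec.scale_left_diff_distrib)

lemma \<kappa>_eq_iff: "\<kappa> a = \<kappa> b \<longleftrightarrow> a - b \<in> M"
  by (simp add: \<kappa>_def torus_proj_eq_iff[OF lat] M_def vec.scale_left_diff_distrib)

lemma M_finite: "finite (M \<inter> cball 0 R)"
proof (rule inj_on_finite)
  show "inj_on (\<lambda>s. s *s w) (M \<inter> cball 0 R)"
    using w(2) unfolding inj_on_def by (metis vec.scale_right_imp_eq)
  show "(\<lambda>s. s *s w) ` (M \<inter> cball 0 R) \<subseteq> \<Lambda> \<inter> cball 0 (R * norm w)"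
    by (auto simp: M_def norm_vector_smult mult_right_mono)
qed (rule lattice_finite_cball[OF lat])

text \<open>Otherwise the periods in \<open>W\<close> would span at most a real line, whereas their
  real span is the complex line \<open>W\<close>; then 1 and \<open>\<i>\<close> would be real
  multiples of one number.\<close>

lemma M_off_line: "\<not> M \<subseteq> range (\<lambda>r. of_real r * u)"
proof
  assume M: "M \<subseteq> range (\<lambda>r. of_real r * u)"
  have "W \<inter> \<Lambda> \<subseteq> span {u *s w}"
  proof
    fix y assume y: "y \<in> W \<inter> \<Lambda>"
    then obtain s where "y = s *s w" "s \<in> M" by (auto simp: mem_W M_def)
    then obtain r where "y = (of_real r * u) *s w" using M by blast
    then have "y = r *\<^sub>R (u *s w)"
      unfolding scaleR_eq_vector_smult by (simp only: vec.scale_scale)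
    then show "y \<in> span {u *s w}" unfolding span_singleton by blast
  qed
  then have "span (W \<inter> \<Lambda>) \<subseteq> span {u *s w}" by (rule span_minimal) (rule subspace_span)
  then have sub: "W \<subseteq> span {u *s w}" using W(3) by (simp add: lattice_in_def)
  have real: "\<exists>r. s = of_real r * u" for s
  proof -
    have "s *s w \<in> span {u *s w}" using sub mem_W by blast
    then obtain r where "s *s w = (of_real r * u) *s w"
      unfolding span_singleton scaleR_eq_vector_smult by (auto simp only: vec.scale_scale)
    then have "s = of_real r * u" using w(2) vec.scale_right_imp_eq by blast
    then show ?thesis by blast
  qed
  obtain r1 r2 where r: "1 = of_real r1 * u" "\<i> = of_real r2 * u" using real by metis
  then have "\<i> * of_real r1 = of_real r2" by (metis mult.assoc mult.commute mult.right_neutral)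
  then have "r1 = 0" by (simp add: complex_eq_iff)
  with r show False by simp
qed

text \<open>The semicharacter has modulus 1, so its value is an exponential and joins the other
  terms independent of \<open>z\<close> in \<open>c\<close>.\<close>

lemma theta_quasi_periodic:
  assumes "\<mu> \<in> \<Lambda>"
  obtains c where "\<And>z. \<theta> (z + \<mu>) = exp (c + of_real pi * H z \<mu>) * \<theta> z"
proof -
  obtain \<alpha> where \<alpha>: "semicharacter \<Lambda> H \<alpha>" "\<And>y z. y \<in> \<Lambda> \<Longrightarrow>
    \<theta> (z + y) = \<alpha> y * exp (of_real pi * H z y + of_real (pi / 2) * H y y) * \<theta> z"
    using theta unfolding theta_function_def by blast
  have "norm (\<alpha> \<mu>) = 1" using \<alpha>(1) assms by (simp add: semicharacter_def)
  then have "exp (Ln (\<alpha> \<mu>)) = \<alpha> \<mu>" by (intro exp_Ln) auto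
  then have "\<theta> (z + \<mu>) = exp (Ln (\<alpha> \<mu>) + of_real (pi / 2) * H \<mu> \<mu> + of_real pi * H z \<mu>) * \<theta> z" for z
    unfolding \<alpha>(2)[OF assms] by (simp add: exp_add mult_ac)
  then show ?thesis by (rule that)
qed

lemma theta_zero_translate:
  assumes "\<mu> \<in> \<Lambda>"
  shows "\<theta> (z + \<mu>) = 0 \<longleftrightarrow> \<theta> z = 0"
  using theta_quasi_periodic[OF assms] by (metis exp_not_eq_zero mult_eq_0_iff)

text \<open>Conjugate-linearity in the second argument produces the factor \<open>cnj l\<close>; the
  part coming from the translation \<open>x\<close> is constant in \<open>s\<close>.\<close>

lemma f_quasi_periodic:
  assumes "l \<in> M"
  obtains c where "\<And>s. f (s + l) = exp (c + (of_real pi * cnj l * H w w) * s) * f s"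
proof -
  have "l *s w \<in> \<Lambda>" using assms by (simp add: M_def)
  from theta_quasi_periodic[OF this]
  obtain c where c: "\<And>z. \<theta> (z + l *s w) = exp (c + of_real pi * H z (l *s w)) * \<theta> z" by blast
  have "f (s + l) = exp (c + of_real pi * H x (l *s w) + (of_real pi * cnj l * H w w) * s) * f s" for s
    using c[of "x + s *s w"]
    by (simp add: f_def vec.scale_left_distrib add.assoc algebra_simps
        hermitian_form_left[OF herm] hermitian_form_right[OF herm])
  then show ?thesis by (rule that)
qed

lemma f_holomorphic: "f holomorphic_on UNIV"
  unfolding f_def[abs_def]
  by (rule holomorphic_C2_on_line) (use theta in \<open>simp add: theta_function_def\<close>)

lemma zero_on_coset: "(\<forall>z\<in>\<kappa> s. \<theta> (x + z) = 0) \<longleftrightarrow> f s = 0"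
proof -
  have "\<theta> (x + z) = 0 \<longleftrightarrow> f s = 0" if z: "z \<in> \<kappa> s" for z
    using theta_zero_translate[of "z - s *s w" "x + s *s w"] z
    by (simp add: f_def \<kappa>_def mem_torus_proj)
  moreover have "s *s w \<in> \<kappa> s" using lattice_closed(1)[OF lat] by (simp add: \<kappa>_def mem_torus_proj)
  ultimately show ?thesis by blast
qed

text \<open>Any point where \<open>\<theta>\<close> does not vanish is itself a proper translation,
  as the curve contains the origin. Hence the chosen \<open>x\<close> is proper.\<close>

lemma f_nonzero: "\<exists>s. f s \<noteq> 0"
proof -
  obtain z where "\<theta> z \<noteq> 0" using theta by (auto simp: theta_function_def)
  moreover have "\<kappa> 0 \<in> F" by (simp add: F_eq)
  moreover have "0 \<in> \<kappa> 0"
    using lattice_closed(1)[OF lat] by (simp add: \<kappa>_def mem_torus_proj)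
  ultimately have "proper_translate \<theta> z F"
    unfolding proper_translate_def by (metis add.right_neutral)
  then have "proper_translate \<theta> x F" unfolding x_def by (rule someI)
  then obtain p z where "p \<in> F" "z \<in> p" "\<theta> (x + z) \<noteq> 0" by (auto simp: proper_translate_def)
  then show ?thesis using zero_on_coset by (auto simp: F_eq)
qed

lemma f_eventually_nonzero: "eventually (\<lambda>s. f s \<noteq> 0) (at s0)"
  using f_nonzero non_zero_neighbour_alt[OF f_holomorphic open_UNIV connected_UNIV, of s0] by auto

lemma f_analytic: "f analytic_on A"
  using f_holomorphic analytic_on_open analytic_on_subset open_UNIV by blast

text \<open>The chosen representative differs from \<open>s *s w\<close> by a lattice vector, which
  multiplies the function by a nowhere vanishing exponential and so keeps the order.\<close>

lemma local_mult_eq: "local_mult \<Lambda> \<theta> x F (\<kappa> s) = zorder f s"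
proof -
  define z where "z = (SOME z. z \<in> \<kappa> s)"
  have "s *s w \<in> \<kappa> s" using lattice_closed(1)[OF lat] by (simp add: \<kappa>_def mem_torus_proj)
  then have "z \<in> \<kappa> s" unfolding z_def by (rule someI)
  then have "z - s *s w \<in> \<Lambda>" by (simp add: \<kappa>_def mem_torus_proj)
  from theta_quasi_periodic[OF this]
  obtain c where c: "\<And>y. \<theta> (y + (z - s *s w)) = exp (c + of_real pi * H y (z - s *s w)) * \<theta> y" by blast
  define g where "g = (\<lambda>u. exp (c + of_real pi * (H x (z - s *s w) + (u + s) * H w (z - s *s w))))"
  have eq: "\<theta> (x + z + u *s w) = g u * f (u + s)" for u
    using c[of "x + (u + s) *s w"]
    by (simp add: f_def g_def vec.scale_left_distrib hermitian_form_left[OF herm] algebra_simps)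
  have g: "g analytic_on {0}" "g 0 \<noteq> 0"
    unfolding g_def by (auto intro!: analytic_intros)
  have fs: "(\<lambda>u. f (u + s)) analytic_on {0}"
  proof -
    have "(\<lambda>u. u + s) analytic_on {0}" by (intro analytic_intros)
    from analytic_on_compose[OF this f_analytic] show ?thesis by (simp add: o_def)
  qed
  have ev: "eventually (\<lambda>u. f (u + s) \<noteq> 0) (at 0)"
    using f_eventually_nonzero[of s] by (simp add: at_to_0[of s] eventually_filtermap)
  have "zorder (\<lambda>u. g u * f (u + s)) 0 = zorder g 0 + zorder (\<lambda>u. f (u + s)) 0"
    by (rule zorder_times_analytic[OF g(1) fs]) (use ev in \<open>simp add: g_def\<close>)
  also have "zorder g 0 = 0" by (rule zorder_eq_0I[OF g])
  also have "zorder (\<lambda>u. f (u + s)) 0 = zorder f s" by (rule zorder_shift[symmetric])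
  finally show ?thesis
    unfolding local_mult_def z_def[symmetric] w_def[symmetric] eq by simp
qed

lemma f_zorder_nonneg: "zorder f s \<ge> 0"
  by (rule zorder_ge_0[OF f_analytic]) (use f_eventually_nonzero in \<open>simp add: eventually_frequently\<close>)

lemma zero_cosets_eq: "{p \<in> F. \<forall>z\<in>p. \<theta> (x + z) = 0} = \<kappa> ` {s. f s = 0}"
  unfolding F_eq using zero_on_coset by auto

lemma short_period_bound:
  obtains v where "v \<in> \<Lambda>" "v \<noteq> 0" "v \<in> W" "Re (H v v) \<le> 2 * of_int (curve_degree \<Lambda> \<theta> F)"
proof -
  obtain l1 l2 where l: "l1 \<in> M" "l2 \<in> M" "l1 \<noteq> 0" and pb: "period_basis l1 l2"
    and short: "(cmod l1)\<^sup>2 \<le> 2 * Im (cnj l1 * l2)"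
    and sep: "\<And>u. u \<in> M \<Longrightarrow> \<bar>period_basis.U l1 l2 u\<bar> < 1 \<Longrightarrow> \<bar>period_basis.V l1 l2 u\<bar> < 1 \<Longrightarrow> u = 0"
    using reduced_period_basis[OF M_closed M_finite M_off_line] by blast
  interpret period_basis l1 l2 by (rule pb)
  define h where "h = Re (H w w)"
  have "h > 0" using pol w by (auto simp: polarization_def h_def)
  have "Im (H w w) = 0"
    using herm unfolding hermitian_form_def by (metis complex_cnj_cancel_iff cnj.simps(2) equal_neg_zero)
  then have h: "H w w = of_real h" by (simp add: h_def complex_eq_iff)
  obtain c1 where c1: "\<And>s. f (s + l1) = exp (c1 + (of_real pi * cnj l1 * H w w) * s) * f s"
    using f_quasi_periodic[OF l(1)] by blast
  obtain c2 where c2: "\<And>s. f (s + l2) = exp (c2 + (of_real pi * cnj l2 * H w w) * s) * f s"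
    using f_quasi_periodic[OF l(2)] by blast
  obtain s0 where "f s0 \<noteq> 0" using f_nonzero by blast
  obtain P where P: "finite P" "\<And>p. p \<in> P \<Longrightarrow> f p = 0"
    "\<And>p q. p \<in> P \<Longrightarrow> q \<in> P \<Longrightarrow> \<bar>U (p - q)\<bar> < 1 \<and> \<bar>V (p - q)\<bar> < 1"
    and count: "2 * pi * \<i> * (\<Sum>p\<in>P. of_int (zorder f p))
        = (of_real pi * cnj l1 * H w w) * l2 - (of_real pi * cnj l2 * H w w) * l1"
    using quasi_periodic_zero_count[OF f_holomorphic \<open>f s0 \<noteq> 0\<close> c1 c2] by metis
  \<comment> \<open>The right side of \<open>count\<close> is pi * h times cnj l1 * l2 minus its
    conjugate, that is, 2 * i times the area of the parallelogram.\<close>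
  have "2 * pi * \<i> * (\<Sum>p\<in>P. of_int (zorder f p)) = 2 * pi * \<i> * of_real (h * Im (cnj l1 * l2))"
    unfolding count h by (simp add: complex_eq_iff algebra_simps)
  then have "(\<Sum>p\<in>P. complex_of_int (zorder f p)) = of_real (h * Im (cnj l1 * l2))"
    by simp
  then have "complex_of_real (of_int (\<Sum>p\<in>P. zorder f p)) = of_real (h * Im (cnj l1 * l2))"
    by simp
  then have sum: "of_int (\<Sum>p\<in>P. zorder f p) = h * Im (cnj l1 * l2)"
    by (simp only: of_real_eq_iff)
  have inj: "inj_on \<kappa> P"
  proof (rule inj_onI)
    fix p q assume pq: "p \<in> P" "q \<in> P" "\<kappa> p = \<kappa> q"
    then have "p - q \<in> M" by (simp add: \<kappa>_eq_iff)
    then have "p - q = 0" using P(3)[OF pq(1,2)] by (intro sep) auto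
    then show "p = q" by simp
  qed
  \<comment> \<open>Every zero is congruent to one in the closed parallelogram at the origin, which
    lies in this ball. So the zeros form finitely many cosets and the sum defining the degree is a
    genuine one.\<close>
  define K where "K = {s \<in> cball 0 (cmod l1 + cmod l2). f s = 0}"
  have finK: "finite K"
    unfolding K_def by (rule zeros_finite_entire[OF f_holomorphic \<open>f s0 \<noteq> 0\<close> compact_cball])
  have sub: "\<kappa> ` {s. f s = 0} \<subseteq> \<kappa> ` K"
  proof safe
    fix s assume s: "f s = 0"
    \<comment> \<open>The second term is a subtraction with a negated floor because
      \<open>M_closed\<close> provides closure under differences.\<close>
    define m where "m = of_int \<lfloor>U s\<rfloor> * l1 - of_int (- \<lfloor>V s\<rfloor>) * l2"
    have "m \<in> M"
      unfolding m_def
      by (intro M_closed(2) subgroup_of_int_mult[OF M_closed l(1)] subgroup_of_int_mult[OF M_closed l(2)])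
    define s' where "s' = s - m"
    have \<kappa>: "\<kappa> s = \<kappa> s'" using \<open>m \<in> M\<close> by (simp add: \<kappa>_eq_iff s'_def)
    have "s' = of_real (frac (U s)) * l1 + of_real (frac (V s)) * l2"
      using decomp[of s] unfolding s'_def m_def frac_def by (simp add: algebra_simps)
    then have "cmod s' \<le> cmod (of_real (frac (U s)) * l1) + cmod (of_real (frac (V s)) * l2)"
      using norm_triangle_ineq by metis
    also have "\<dots> \<le> 1 * cmod l1 + 1 * cmod l2"
      unfolding norm_mult
      by (intro add_mono mult_right_mono) (auto simp: frac_lt_1[THEN less_imp_le])
    finally have "cmod s' \<le> cmod l1 + cmod l2" by simp
    moreover have "f s' = 0" using s \<kappa> zero_on_coset by metis
    ultimately show "\<kappa> s \<in> \<kappa> ` K" unfolding \<kappa> K_def by simp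
  qed
  have "(\<Sum>p\<in>P. zorder f p) = (\<Sum>p\<in>\<kappa> ` P. local_mult \<Lambda> \<theta> x F p)"
    by (simp add: sum.reindex[OF inj] local_mult_eq)
  \<comment> \<open>\<open>f\<close> is entire, so the orders at zeros outside the image of
    \<open>P\<close> are nonnegative and enlarge the sum.\<close>
  also have "\<dots> \<le> (\<Sum>p\<in>\<kappa> ` {s. f s = 0}. local_mult \<Lambda> \<theta> x F p)"
  proof (rule sum_mono2)
    show "finite (\<kappa> ` {s. f s = 0})" using finK sub finite_subset by blast
    show "\<kappa> ` P \<subseteq> \<kappa> ` {s. f s = 0}" using P(2) by auto
  qed (auto simp: local_mult_eq f_zorder_nonneg)
  also have "\<dots> = curve_degree \<Lambda> \<theta> F"
    unfolding curve_degree_def proper_intersection_def x_def[symmetric] zero_cosets_eq ..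
  finally have deg: "h * Im (cnj l1 * l2) \<le> of_int (curve_degree \<Lambda> \<theta> F)"
    unfolding sum[symmetric] by (simp only: of_int_le_iff)
  show ?thesis
  proof (rule that[of "l1 *s w"])
    show "l1 *s w \<in> \<Lambda>" using l by (simp add: M_def)
    show "l1 *s w \<noteq> 0" using l w by simp
    show "l1 *s w \<in> W" using mem_W by blast
    have "Re (H (l1 *s w) (l1 *s w)) = (cmod l1)\<^sup>2 * h"
      unfolding h_def by (rule hermitian_form_self_scale[OF herm])
    also have "\<dots> \<le> 2 * Im (cnj l1 * l2) * h"
      using short \<open>h > 0\<close> by (intro mult_right_mono) auto
    also have "\<dots> = 2 * (h * Im (cnj l1 * l2))" by (simp only: mult_ac)
    also have "\<dots> \<le> 2 * of_int (curve_degree \<Lambda> \<theta> F)"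
      by (rule mult_left_mono[OF deg]) simp
    finally show "Re (H (l1 *s w) (l1 *s w)) \<le> 2 * of_int (curve_degree \<Lambda> \<theta> F)" .
  qed
qed

end

section \<open>Counting curves by short lattice vectors\<close>

lemma curves_upto_le_lattice_points:
  assumes lat: "lattice_in UNIV \<Lambda>" and pol: "polarization \<Lambda> H" and theta: "theta_function \<Lambda> H \<theta>"
    and c: "c > 0" "\<And>x. c * (norm x)\<^sup>2 \<le> Re (H x x)"
  shows "curves_upto \<Lambda> \<theta> t \<subseteq>
    (\<lambda>v. torus_proj \<Lambda> ` range (\<lambda>s. s *s v)) ` (\<Lambda> \<inter> cball 0 (sqrt (2 * real t / c)))"
proof
  fix F assume F: "F \<in> curves_upto \<Lambda> \<theta> t"
  then obtain W where W: "F = torus_proj \<Lambda> ` W" "vec.subspace W" "vec.dim W = 1" "lattice_in W (W \<inter> \<Lambda>)"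
    by (auto simp: curves_upto_def elliptic_curves_def)
  interpret E: elliptic_curve_in_torus \<Lambda> H \<theta> W
    by standard (use assms W in auto)
  obtain v where v: "v \<in> \<Lambda>" "v \<noteq> 0" "v \<in> W" "Re (H v v) \<le> 2 * of_int (curve_degree \<Lambda> \<theta> F)"
    using E.short_period_bound unfolding E.F_def W(1) by blast
  have "curve_degree \<Lambda> \<theta> F \<le> int t" using F by (simp add: curves_upto_def)
  then have "real_of_int (curve_degree \<Lambda> \<theta> F) \<le> real t" by linarith
  \<comment> \<open>Origin of the radius: coercivity bounds the left side by the squared H-length of
    \<open>v\<close>, which is at most twice the degree.\<close>
  then have "c * (norm v)\<^sup>2 \<le> 2 * real t" using c(2)[of v] v(4) by linarith
  then have "(norm v)\<^sup>2 \<le> 2 * real t / c" using c(1) by (simp add: field_simps)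
  then have "norm v \<le> sqrt (2 * real t / c)" by (simp add: real_le_rsqrt)
  moreover have "F = torus_proj \<Lambda> ` range (\<lambda>s. s *s v)"
    unfolding W(1) using vec_subspace_dim_1[OF W(2,3) v(3,2)] by simp
  ultimately show "F \<in> (\<lambda>v. torus_proj \<Lambda> ` range (\<lambda>s. s *s v)) ` (\<Lambda> \<inter> cball 0 (sqrt (2 * real t / c)))"
    using v(1) by auto
qed

text \<open>Finiteness is stated separately because \<open>card\<close> is 0 on infinite sets, which
  would make the growth bound empty.\<close>

theorem mainTheorem5:
  fixes \<Lambda> :: "(complex ^ 2) set"
    and H :: "complex ^ 2 \<Rightarrow> complex ^ 2 \<Rightarrow> complex"
    and \<theta> :: "complex ^ 2 \<Rightarrow> complex"
  assumes "lattice_in UNIV \<Lambda>"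
    and "polarization \<Lambda> H"
    and "theta_function \<Lambda> H \<theta>"
  shows "(\<forall>t\<ge>1. finite (curves_upto \<Lambda> \<theta> t)) \<and>
         (\<lambda>t. real (card (curves_upto \<Lambda> \<theta> t))) \<in> O(\<lambda>t. real t ^ 3)"
proof -
  obtain c where c: "c > 0" "\<And>x. c * (norm x)\<^sup>2 \<le> Re (H x x)"
    using polarization_coercive[OF assms(2)] by blast
  obtain \<delta> where \<delta>: "\<delta> > 0" "\<And>x y. x \<in> \<Lambda> \<Longrightarrow> y \<in> \<Lambda> \<Longrightarrow> x \<noteq> y \<Longrightarrow> \<delta> \<le> dist x y"
    using lattice_separated[OF assms(1)] by blast
  define R where "R t = sqrt (2 * real t / c)" for t :: nat
  have R0: "R t \<ge> 0" for t using c(1) by (simp add: R_def)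
  note sub = curves_upto_le_lattice_points[OF assms c, folded R_def]
  have fin: "finite (\<Lambda> \<inter> cball 0 (R t))" for t
    using separated_finite_card_le(1)[OF \<delta>(2,1) R0] by blast
  then have fin_curves: "finite (curves_upto \<Lambda> \<theta> t)" for t
    using sub[of t] by (metis finite_imageI finite_subset)
  \<comment> \<open>The exponent is the real dimension of the ambient space. Since sqrt t \<ge> 1,
    the summand 1 of the packing bound can be multiplied by sqrt t, and its fourth power gives
    t^2.\<close>
  define K where "K = (1 + 2 * sqrt (2 / c) / \<delta>) ^ 4"
  have "real (card (curves_upto \<Lambda> \<theta> t)) \<le> K * real t ^ 3" if "t \<ge> 1" for t
  proof -
    have "card (curves_upto \<Lambda> \<theta> t) \<le> card (\<Lambda> \<inter> cball 0 (R t))"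
      using sub[of t] fin by (meson card_image_le card_mono finite_imageI order_trans)
    also have "real \<dots> \<le> (1 + 2 * R t / \<delta>) ^ 4"
      using separated_finite_card_le(2)[OF \<delta>(2,1) R0, of \<Lambda> t] by simp
    also have "\<dots> \<le> ((1 + 2 * sqrt (2 / c) / \<delta>) * sqrt (real t)) ^ 4"
    proof (rule power_mono)
      have "R t = sqrt (2 / c) * sqrt (real t)" by (simp add: R_def real_sqrt_mult[symmetric])
      moreover have "1 \<le> sqrt (real t)" using that by simp
      ultimately show "1 + 2 * R t / \<delta> \<le> (1 + 2 * sqrt (2 / c) / \<delta>) * sqrt (real t)"
        by (simp add: algebra_simps)
      show "0 \<le> 1 + 2 * R t / \<delta>" using R0[of t] \<delta>(1) by simp
    qed
    also have "\<dots> = K * real t ^ 2"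
      unfolding K_def power_mult_distrib by (simp add: power4_eq_xxxx power2_eq_square)
    also have "\<dots> \<le> K * real t ^ 3"
      using that c(1) \<delta>(1) unfolding K_def
      by (intro mult_left_mono power_increasing zero_le_power) auto
    finally show ?thesis by simp
  qed
  then have "(\<lambda>t. real (card (curves_upto \<Lambda> \<theta> t))) \<in> O(\<lambda>t. real t ^ 3)"
    by (intro bigoI[of _ K] eventually_at_top_linorderI[of 1]) simp
  with fin_curves show ?thesis by blast
qed

end
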